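(* Let $X_0=\partial_x$ and $X_3=x^3\partial_x$ be vector fields on $\mathbb{R}$. For every $n\ge 1$, let $\mathcal{M}=\mathcal{M}^n(\mathbb{R})$ be the landmark manifold of $n$ pairwise distinct points in $\mathbb{R}$, let $\mathcal{E}=\operatorname{span}\{\ell X_0,\ell X_3\}\subseteq T\mathcal{M}$, and let $$\mathcal{M}_<=\{(x_1,\dots,x_n)\in\mathbb{R}^n : x_1<x_2<\cdots<x_n\}.$$ Then there is complete controllability on $\mathcal{M}_<$ with respect to $\mathcal{E}$ (for every $n$).
   Context: The landmark manifold is the open set $\mathcal{M}^n(\mathbb{R}^d)=\{\mathbf{x}=(x_1,\dots,x_n): x_i\in\mathbb{R}^d,\ x_{i_1}\ne x_{i_2}\text{ whenever } i_1\neq i_2\}\subseteq(\mathbb{R}^d)^n$. For a vector field $X$ on $\mathbb{R}^d$, $\ell X$ is the vector field on $\mathcal{M}^n(\mathbb{R}^d)$ given by $\ell X(x_1,\dots,x_n)=(X(x_1),\dots,X(x_n))$. Here $d=1$, and $\mathcal{M}_<$ is one connected component of $\mathcal{M}^n(\mathbb{R})$. The span of vector fields is taken pointwise: $\mathcal{E}_{\mathbf{x}}=\operatorname{span}_{\mathbb{R}}\{\ell X_0(\mathbf{x}),\ell X_3(\mathbf{x})\}$. An absolutely continuous curve $\gamma:[0,1]\to M$ in a manifold $M$ is horizontal with respect to $\mathcal{E}\subseteq TM$ if $\dot\gamma(t)\in\mathcal{E}_{\gamma(t)}$ for almost every $t$. The orbit $O_q$ of $\mathcal{E}$ at $q\in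 M$ is the set of $p\in M$ for which there is a horizontal curve $\gamma$ with $\gamma(0)=q$, $\gamma(1)=p$. Complete controllability on $M$ with respect to $\mathcal{E}$ means $O_q=M$ for every $q\in M$. When $\mathcal{E}$ is spanned by vector fields $Z_1,\dots,Z_m$, the orbit $O_q$ is also described as the set of all points $e^{t_1Z_{i_1}}\circ\cdots\circ e^{t_lZ_{i_l}}(q)$ with $t_j\in\mathbb{R}$, $i_j\in\{1,\dots,m\}$, $l\ge1$, where $e^{tZ}$ is the (local) flow of $Z$. *)

theory Defs
  imports "HOL-Analysis.Analysis"
begin

text \<open>Configurations of \<open>n\<close> points in \<open>'a\<close> are the elements of \<open>'a^'n\<close>. The index type
  \<open>'n\<close> is finite, and it is also linearly ordered where the order of the points matters: it plays
  the role of \<open>{1,\<dots>,n}\<close> with \<open>n = CARD('n) \<ge> 1\<close>.\<close>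

definition landmark_manifold :: "('a::euclidean_space ^ 'n::finite) set" where
  "landmark_manifold = {x. \<forall>i j. i \<noteq> j \<longrightarrow> x $ i \<noteq> x $ j}"

definition ordered_landmarks :: "(real ^ 'n::{finite,linorder}) set" where
  "ordered_landmarks = {x. \<forall>i j. i < j \<longrightarrow> x $ i < x $ j}"

definition lift_vf :: "('a::euclidean_space \<Rightarrow> 'a) \<Rightarrow> 'a ^ 'n::finite \<Rightarrow> 'a ^ 'n" where
  "lift_vf X x = (\<chi> i. X (x $ i))"

text \<open>For an open set \<open>M\<close> of a Euclidean space \<open>'e\<close>, the tangent bundle \<open>TM\<close> is \<open>M \<times> 'e\<close>. A
  distribution on \<open>M\<close> is given as a set of pairs (base point, tangent vector).\<close>

definition span_distribution ::
    "'e::euclidean_space set \<Rightarrow> ('e \<Rightarrow> 'e) set \<Rightarrow> ('e \<times> 'e) set" where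
  "span_distribution M Zs = {(x, v). x \<in> M \<and> v \<in> span {Z x | Z. Z \<in> Zs}}"

text \<open>The usual \<open>\<epsilon>\<close>-\<open>\<delta>\<close> definition: \<open>D division_of \<Union>D\<close> says that \<open>D\<close> is a finite set of
  nonempty compact intervals \<open>K = {Inf K..Sup K}\<close> with pairwise disjoint interiors.\<close>

definition absolutely_continuous_on ::
    "real \<Rightarrow> real \<Rightarrow> (real \<Rightarrow> 'e::euclidean_space) \<Rightarrow> bool" where
  "absolutely_continuous_on a b f \<longleftrightarrow>
     (\<forall>\<epsilon>>0. \<exists>\<delta>>0. \<forall>D. D division_of \<Union>D \<and> \<Union>D \<subseteq> {a..b} \<and> (\<Sum>K\<in>D. Sup K - Inf K) < \<delta>
        \<longrightarrow> (\<Sum>K\<in>D. norm (f (Sup K) - f (Inf K))) < \<epsilon>)"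

definition horizontal_curve ::
    "'e::euclidean_space set \<Rightarrow> ('e \<times> 'e) set \<Rightarrow> (real \<Rightarrow> 'e) \<Rightarrow> bool" where
  "horizontal_curve M E \<gamma> \<longleftrightarrow>
     \<gamma> ` {0..1} \<subseteq> M \<and> absolutely_continuous_on 0 1 \<gamma> \<and>
     (AE t in lebesgue. t \<in> {0..1} \<longrightarrow>
        (\<exists>v. (\<gamma> has_vector_derivative v) (at t within {0..1}) \<and> (\<gamma> t, v) \<in> E))"

definition orbit ::
    "'e::euclidean_space set \<Rightarrow> ('e \<times> 'e) set \<Rightarrow> 'e \<Rightarrow> 'e set" where
  "orbit M E q = {p \<in> M. \<exists>\<gamma>. horizontal_curve M E \<gamma> \<and> \<gamma> 0 = q \<and> \<gamma> 1 = p}"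

text \<open>Complete controllability on an open subset \<open>N\<close> of \<open>M\<close>, with respect to a distribution \<open>E\<close>
  on \<open>M\<close>. The curves that define the orbits are only required to stay in \<open>M\<close>, so that the equality
  says both that all of \<open>N\<close> can be reached from each of its points and that \<open>N\<close> cannot be left.
  For \<open>N = M\<close> this is complete controllability on \<open>M\<close>.\<close>

definition completely_controllable_on ::
    "'e::euclidean_space set \<Rightarrow> 'e set \<Rightarrow> ('e \<times> 'e) set \<Rightarrow> bool" where
  "completely_controllable_on N M E \<longleftrightarrow> (\<forall>q\<in>N. orbit M E q = N)"

end

theory Submission
  imports Defs
begin

text \<open>The points reachable from a configuration form an equivalence class, and
  \<open>ordered_landmarks\<close> is convex, so it suffices that every class is open; it is never left, since
  landmarks on a line cannot pass each other. For openness, conjugate the translations by the flow of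
  \<open>(x - a)\<^sup>3 \<partial>\<^sub>x\<close>, which is itself a translate of the flow of \<open>X3\<close>. The resulting motions have the
  initial velocities \<open>(1 + c (x\<^sub>i - a)\<^sup>2)\<^sup>3\<^sup>/\<^sup>2\<close> with \<open>c > 0\<close>. A covector \<open>l\<close> that annihilates all of
  them satisfies \<open>\<Sum>\<^sub>i l\<^sub>i \<bar>x\<^sub>i - a\<bar>\<^sup>3 = 0\<close> for all \<open>a\<close> (let \<open>c \<rightarrow> \<infinity>\<close>), and
  the kinks of this function of \<open>a\<close> force \<open>l = 0\<close>. So the velocities span, and the composition of
  such motions is open at time \<open>0\<close>.\<close>

section \<open>Reachability by Lipschitz curves\<close>

lemma lipschitz_on_imp_absolutely_continuous_on:
  fixes f :: "real \<Rightarrow> 'e::euclidean_space"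
  assumes "L-lipschitz_on {a..b} f"
  shows "absolutely_continuous_on a b f"
  unfolding absolutely_continuous_on_def
proof (intro allI impI)
  fix \<epsilon> :: real assume "\<epsilon> > 0"
  have L: "L \<ge> 0" using assms by (rule lipschitz_on_nonneg)
  \<comment> \<open>Dividing by \<open>L + 1\<close> instead of \<open>L\<close> covers
    \<open>L = 0\<close> and makes the last inequality strict.\<close>
  have "(\<Sum>K\<in>D. norm (f (Sup K) - f (Inf K))) < \<epsilon>"
    if D: "D division_of \<Union>D" "\<Union>D \<subseteq> {a..b}" "(\<Sum>K\<in>D. Sup K - Inf K) < \<epsilon> / (L + 1)" for D
  proof -
    have "norm (f (Sup K) - f (Inf K)) \<le> L * (Sup K - Inf K)" if "K \<in> D" for K
    proof -
      obtain u v where K: "K = {u..v}" "K \<noteq> {}"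
        using division_ofD(3,4)[OF D(1) \<open>K \<in> D\<close>] by (metis cbox_interval)
      then have "u \<le> v" "u \<in> {a..b}" "v \<in> {a..b}"
        using subset_trans[OF Union_upper[OF \<open>K \<in> D\<close>] D(2)] by auto
      then show ?thesis
        using lipschitz_onD[OF assms, of v u] K by (simp add: dist_norm)
    qed
    then have "(\<Sum>K\<in>D. norm (f (Sup K) - f (Inf K))) \<le> L * (\<Sum>K\<in>D. Sup K - Inf K)"
      unfolding sum_distrib_left by (rule sum_mono)
    also have "\<dots> \<le> L * (\<epsilon> / (L + 1))"
      using D(3) L by (intro mult_left_mono) auto
    also have "\<dots> < \<epsilon>"
      using L \<open>\<epsilon> > 0\<close> by (simp add: field_simps)
    finally show ?thesis .
  qed
  then show "\<exists>\<delta>>0. \<forall>D. D division_of \<Union>D \<and> \<Union>D \<subseteq> {a..b} \<and> (\<Sum>K\<in>D. Sup K - Inf K) < \<delta>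
        \<longrightarrow> (\<Sum>K\<in>D. norm (f (Sup K) - f (Inf K))) < \<epsilon>"
    using L \<open>\<epsilon> > 0\<close> by (intro exI[of _ "\<epsilon> / (L + 1)"]) auto
qed

text \<open>Serves the intermediate value argument that keeps orbits inside
  \<open>ordered_landmarks\<close>. Divisions with a single interval suffice for it.\<close>

lemma absolutely_continuous_on_imp_continuous_on:
  fixes f :: "real \<Rightarrow> 'e::euclidean_space"
  assumes "absolutely_continuous_on a b f"
  shows "continuous_on {a..b} f"
  unfolding continuous_on_iff
proof (intro ballI allI impI)
  fix x \<epsilon> :: real assume x: "x \<in> {a..b}" and "\<epsilon> > 0"
  then obtain \<delta> where "\<delta> > 0" and \<delta>: "\<And>D. D division_of \<Union>D \<Longrightarrow> \<Union>D \<subseteq> {a..b} \<Longrightarrow>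
      (\<Sum>K\<in>D. Sup K - Inf K) < \<delta> \<Longrightarrow> (\<Sum>K\<in>D. norm (f (Sup K) - f (Inf K))) < \<epsilon>"
    using assms unfolding absolutely_continuous_on_def by meson
  have *: "dist (f v) (f u) < \<epsilon>" if "u \<in> {a..b}" "v \<in> {a..b}" "u \<le> v" "v - u < \<delta>" for u v
    using \<delta>[of "{{u..v}}"] division_of_self[of u v] that by (simp add: dist_norm)
  have "dist (f y) (f x) < \<epsilon>" if "y \<in> {a..b}" "dist y x < \<delta>" for y
    using *[of x y] *[of y x] x that by (cases "x \<le> y") (auto simp: dist_real_def dist_commute)
  then show "\<exists>d>0. \<forall>y\<in>{a..b}. dist y x < d \<longrightarrow> dist (f y) (f x) < \<epsilon>"
    using \<open>\<delta> > 0\<close> by blast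
qed

lemma span_distribution_scaleR:
  "(x, v) \<in> span_distribution M Zs \<Longrightarrow> (x, c *\<^sub>R v) \<in> span_distribution M Zs"
  by (simp add: span_distribution_def span_scale)

lemma lipschitz_on_affine_reparametrization:
  fixes f :: "real \<Rightarrow> 'e::metric_space"
  assumes "L-lipschitz_on T f" "\<And>x. x \<in> S \<Longrightarrow> m * x + c \<in> T"
  shows "(L * \<bar>m\<bar>)-lipschitz_on S (\<lambda>x. f (m * x + c))"
proof (rule lipschitz_on_compose2[where g = f and f = "\<lambda>x. m * x + c"])
  show "\<bar>m\<bar>-lipschitz_on S (\<lambda>x. m * x + c)"
    by (intro lipschitz_onI) (auto simp: dist_real_def abs_mult[symmetric] right_diff_distrib)
  show "L-lipschitz_on ((\<lambda>x. m * x + c) ` S) f"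
    using assms by (auto intro: lipschitz_on_subset)
qed

text \<open>Stronger than the existence of a horizontal curve: Lipschitz instead of absolutely
  continuous, and a two-sided derivative off a finite set instead of a derivative almost everywhere.
  This form survives reversal and concatenation by elementary checks; the finite set absorbs the
  junctions.\<close>

definition reachable :: "'e::euclidean_space set \<Rightarrow> ('e \<times> 'e) set \<Rightarrow> 'e \<Rightarrow> 'e \<Rightarrow> bool" where
  "reachable M E p q \<longleftrightarrow> (\<exists>\<gamma> L S. \<gamma> ` {0..1} \<subseteq> M \<and> L-lipschitz_on {0..1} \<gamma> \<and> finite S \<and>
     (\<forall>t\<in>{0<..<1} - S. \<exists>v. (\<gamma> has_vector_derivative v) (at t) \<and> (\<gamma> t, v) \<in> E) \<and>
     \<gamma> 0 = p \<and> \<gamma> 1 = q)"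

lemma reachableE:
  assumes "reachable M E p q"
  obtains \<gamma> L S where "\<gamma> ` {0..1} \<subseteq> M" "L-lipschitz_on {0..1} \<gamma>" "finite S"
     "\<And>t. t \<in> {0<..<1} - S \<Longrightarrow> \<exists>v. (\<gamma> has_vector_derivative v) (at t) \<and> (\<gamma> t, v) \<in> E"
     "\<gamma> 0 = p" "\<gamma> 1 = q"
  using assms unfolding reachable_def by blast

lemma reachable_imp_orbit:
  assumes "reachable M E p q"
  shows "q \<in> orbit M E p"
proof -
  obtain \<gamma> L S where \<gamma>: "\<gamma> ` {0..1} \<subseteq> M" "L-lipschitz_on {0..1} \<gamma>" "finite S"
     "\<And>t. t \<in> {0<..<1} - S \<Longrightarrow> \<exists>v. (\<gamma> has_vector_derivative v) (at t) \<and> (\<gamma> t, v) \<in> E"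
     "\<gamma> 0 = p" "\<gamma> 1 = q"
    using assms by (rule reachableE) blast
  \<comment> \<open>The endpoints join the null set because \<open>reachable\<close> speaks of
    derivatives at interior times only.\<close>
  have "negligible (insert 0 (insert 1 S))"
    using \<gamma>(3) by (simp add: negligible_finite)
  then have "AE t in lebesgue. t \<notin> insert 0 (insert 1 S)"
    unfolding negligible_iff_null_sets by (rule AE_not_in)
  then have "AE t in lebesgue. t \<in> {0..1} \<longrightarrow>
      (\<exists>v. (\<gamma> has_vector_derivative v) (at t within {0..1}) \<and> (\<gamma> t, v) \<in> E)"
  proof (rule AE_mp, intro AE_I2 impI)
    fix t :: real assume "t \<notin> insert 0 (insert 1 S)" "t \<in> {0..1}"
    then have "t \<in> {0<..<1} - S" by auto
    then show "\<exists>v. (\<gamma> has_vector_derivative v) (at t within {0..1}) \<and> (\<gamma> t, v) \<in> E"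
      using \<gamma>(4) has_vector_derivative_at_within by blast
  qed
  then show ?thesis
    using \<gamma> lipschitz_on_imp_absolutely_continuous_on[OF \<gamma>(2)]
    unfolding orbit_def horizontal_curve_def by auto
qed

text \<open>The velocity is bounded on the compact interval, so the mean value inequality gives a
  Lipschitz constant; the exceptional set is empty.\<close>

lemma reachable_C1:
  assumes M: "\<And>t. t \<in> {0..1} \<Longrightarrow> \<gamma> t \<in> M"
    and der: "\<And>t. t \<in> {0..1} \<Longrightarrow> (\<gamma> has_vector_derivative \<gamma>' t) (at t)"
    and cont: "continuous_on {0..1} \<gamma>'"
    and E: "\<And>t. t \<in> {0..1} \<Longrightarrow> (\<gamma> t, \<gamma>' t) \<in> E"
  shows "reachable M E (\<gamma> 0) (\<gamma> 1)"
proof -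
  have "bounded (\<gamma>' ` {0..1})"
    by (intro compact_imp_bounded compact_continuous_image cont) auto
  then obtain B where B: "\<And>t. t \<in> {0..1} \<Longrightarrow> norm (\<gamma>' t) \<le> B"
    unfolding bounded_iff by (metis imageI)
  then have "B \<ge> 0"
    by (meson atLeastAtMost_iff dual_order.refl norm_ge_zero order_trans zero_le_one)
  have "norm (\<gamma> x - \<gamma> y) \<le> B * norm (x - y)" if "x \<in> {0..1}" "y \<in> {0..1}" for x y
  proof (rule differentiable_bound[OF _ _ _ that])
    show "(\<gamma> has_derivative (\<lambda>h. h *\<^sub>R \<gamma>' t)) (at t within {0..1})" if "t \<in> {0..1}" for t
      using der[OF that] by (simp add: has_vector_derivative_def has_derivative_at_withinI)
    show "onorm (\<lambda>h::real. h *\<^sub>R \<gamma>' t) \<le> B" if "t \<in> {0..1}" for t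
      using B[OF that] by (intro onorm_le) (simp add: mult.commute[of B] mult_left_mono)
  qed auto
  then have "B-lipschitz_on {0..1} \<gamma>"
    using \<open>B \<ge> 0\<close> by (intro lipschitz_onI) (auto simp: dist_norm)
  moreover have "\<gamma> ` {0..1} \<subseteq> M" using M by auto
  moreover have "\<exists>v. (\<gamma> has_vector_derivative v) (at t) \<and> (\<gamma> t, v) \<in> E" if "t \<in> {0<..<1} - {}" for t
    using der[of t] E[of t] that by auto
  ultimately show ?thesis
    unfolding reachable_def by (metis finite.emptyI)
qed

text \<open>Running the curve backwards negates its velocities, and the fibres of a span are closed
  under negation.\<close>

lemma reachable_sym:
  assumes "reachable M (span_distribution M Zs) p q"
  shows "reachable M (span_distribution M Zs) q p"
proof -
  let ?E = "span_distribution M Zs"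
  obtain \<gamma> L S where \<gamma>: "\<gamma> ` {0..1} \<subseteq> M" "L-lipschitz_on {0..1} \<gamma>" "finite S"
     "\<And>t. t \<in> {0<..<1} - S \<Longrightarrow> \<exists>v. (\<gamma> has_vector_derivative v) (at t) \<and> (\<gamma> t, v) \<in> ?E"
     "\<gamma> 0 = p" "\<gamma> 1 = q"
    using assms by (rule reachableE) blast
  let ?\<gamma> = "\<lambda>t. \<gamma> (1 - t)"
  have "?\<gamma> ` {0..1} \<subseteq> M" using \<gamma>(1) by auto
  moreover have "L-lipschitz_on {0..1} ?\<gamma>"
    using lipschitz_on_affine_reparametrization[OF \<gamma>(2), of "{0..1}" "-1" 1] by simp
  moreover have "finite ((\<lambda>t. 1 - t) ` S)" using \<gamma>(3) by simp
  moreover have "\<exists>v. (?\<gamma> has_vector_derivative v) (at t) \<and> (?\<gamma> t, v) \<in> ?E"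
    if t: "t \<in> {0<..<1} - (\<lambda>t. 1 - t) ` S" for t
  proof -
    have "1 - t \<in> {0<..<1} - S"
      using t by (auto simp: image_iff)
    then obtain v where v: "(\<gamma> has_vector_derivative v) (at (1 - t))" "(\<gamma> (1 - t), v) \<in> ?E"
      using \<gamma>(4) by blast
    have "((\<lambda>t. 1 - t) has_vector_derivative -1) (at t)"
      by (auto intro!: derivative_eq_intros)
    from vector_diff_chain_at[OF this v(1)]
    show ?thesis
      using span_distribution_scaleR[OF v(2), of "-1"] by (auto simp: o_def)
  qed
  ultimately show ?thesis
    using \<gamma>(5,6) unfolding reachable_def
    by (intro exI[of _ ?\<gamma>] exI[of _ L] exI[of _ "(\<lambda>t. 1 - t) ` S"]) auto
qed

text \<open>Each curve is run at double speed on one half of the interval; the fibres, being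
  subspaces, contain the doubled velocities.\<close>

lemma reachable_trans:
  assumes "reachable M (span_distribution M Zs) p q" "reachable M (span_distribution M Zs) q r"
  shows "reachable M (span_distribution M Zs) p r"
proof -
  let ?E = "span_distribution M Zs"
  obtain \<gamma> L S where \<gamma>: "\<gamma> ` {0..1} \<subseteq> M" "L-lipschitz_on {0..1} \<gamma>" "finite S"
     "\<And>t. t \<in> {0<..<1} - S \<Longrightarrow> \<exists>v. (\<gamma> has_vector_derivative v) (at t) \<and> (\<gamma> t, v) \<in> ?E"
     "\<gamma> 0 = p" "\<gamma> 1 = q"
    using assms(1) by (rule reachableE) blast
  obtain \<beta> K T where \<beta>: "\<beta> ` {0..1} \<subseteq> M" "K-lipschitz_on {0..1} \<beta>" "finite T"
     "\<And>t. t \<in> {0<..<1} - T \<Longrightarrow> \<exists>v. (\<beta> has_vector_derivative v) (at t) \<and> (\<beta> t, v) \<in> ?E"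
     "\<beta> 0 = q" "\<beta> 1 = r"
    using assms(2) by (rule reachableE) blast
  let ?\<alpha> = "\<lambda>t. if t \<le> 1/2 then \<gamma> (2 * t) else \<beta> (2 * t - 1)"
  let ?B = "max L K * 2"
  \<comment> \<open>The exceptional times of both curves, carried over to the new time scale,
    together with the junction.\<close>
  let ?U = "insert (1/2) ((\<lambda>t. t / 2) ` S \<union> (\<lambda>t. (t + 1) / 2) ` T)"
  have "?\<alpha> ` {0..1} \<subseteq> M" using \<gamma>(1) \<beta>(1) by auto
  moreover have "?B-lipschitz_on {0..1} ?\<alpha>"
  proof (rule lipschitz_on_concat)
    have 1: "(max L K)-lipschitz_on {0..1} \<gamma>" "(max L K)-lipschitz_on {0..1} \<beta>"
      using lipschitz_on_le[OF \<gamma>(2)] lipschitz_on_le[OF \<beta>(2)] by auto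
    show "?B-lipschitz_on {0..1/2} (\<lambda>t. \<gamma> (2 * t))"
      using lipschitz_on_affine_reparametrization[OF 1(1), of "{0..1/2}" 2 0] by simp
    show "?B-lipschitz_on {1/2..1} (\<lambda>t. \<beta> (2 * t - 1))"
      using lipschitz_on_affine_reparametrization[OF 1(2), of "{1/2..1}" 2 "-1"] by simp
    show "\<gamma> (2 * (1/2)) = \<beta> (2 * (1/2) - 1)" using \<gamma> \<beta> by simp
  qed
  moreover have "finite ?U" using \<gamma>(3) \<beta>(3) by simp
  moreover have "\<exists>v. (?\<alpha> has_vector_derivative v) (at t) \<and> (?\<alpha> t, v) \<in> ?E"
    if t: "t \<in> {0<..<1} - ?U" for t
  proof (cases "t < 1/2")
    case True
    have "2 * t \<in> {0<..<1} - S"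
      using t True by (auto simp: image_iff mult.commute)
    then obtain v where v: "(\<gamma> has_vector_derivative v) (at (2 * t))" "(\<gamma> (2 * t), v) \<in> ?E"
      using \<gamma>(4) by blast
    have "((\<lambda>t. 2 * t) has_vector_derivative 2) (at t)"
      by (auto intro!: derivative_eq_intros)
    from vector_diff_chain_at[OF this v(1)]
    have "((\<lambda>t. \<gamma> (2 * t)) has_vector_derivative 2 *\<^sub>R v) (at t)"
      by (simp add: o_def)
    then have "(?\<alpha> has_vector_derivative 2 *\<^sub>R v) (at t)"
      by (rule has_vector_derivative_transform_within_open[of _ _ _ "{..<1/2}"]) (use True in auto)
    then show ?thesis
      using span_distribution_scaleR[OF v(2), of 2] True by auto
  next
    case False
    then have "t > 1/2" using t by auto
    then have "2 * t - 1 \<in> {0<..<1} - T"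
      using t by (auto simp: image_iff)
    then obtain v where v: "(\<beta> has_vector_derivative v) (at (2 * t - 1))" "(\<beta> (2 * t - 1), v) \<in> ?E"
      using \<beta>(4) by blast
    have "((\<lambda>t. 2 * t - 1) has_vector_derivative 2) (at t)"
      by (auto intro!: derivative_eq_intros)
    from vector_diff_chain_at[OF this v(1)]
    have "((\<lambda>t. \<beta> (2 * t - 1)) has_vector_derivative 2 *\<^sub>R v) (at t)"
      by (simp add: o_def)
    then have "(?\<alpha> has_vector_derivative 2 *\<^sub>R v) (at t)"
      by (rule has_vector_derivative_transform_within_open[of _ _ _ "{1/2<..}"]) (use \<open>t > 1/2\<close> in auto)
    then show ?thesis
      using span_distribution_scaleR[OF v(2), of 2] \<open>t > 1/2\<close> by auto
  qed
  ultimately show ?thesis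
    using \<gamma>(5,6) \<beta>(5,6) unfolding reachable_def
    by (intro exI[of _ ?\<alpha>] exI[of _ ?B] exI[of _ ?U]) auto
qed

lemma reachable_refl:
  assumes "x \<in> M"
  shows "reachable M (span_distribution M Zs) x x"
  using reachable_C1[of "\<lambda>_. x" M "\<lambda>_. 0"] assms
  by (auto simp: span_distribution_def span_zero)

section \<open>Openness of orbits\<close>

text \<open>The maps \<open>G\<close> need not be flows, and need not be continuously differentiable: the open
  mapping theorem used here asks only for continuity and for a derivative at one point.\<close>

lemma interior_related_points:
  fixes q :: "'e::euclidean_space"
  assumes span: "span V = UNIV"
    and refl: "R q q"
    and trans: "\<And>x y z. R x y \<Longrightarrow> R y z \<Longrightarrow> R x z"
    and flow: "\<And>v. v \<in> V \<Longrightarrow> \<exists>U G. open U \<and> (0::real, q) \<in> U \<and> continuous_on U G \<and> G (0, q) = q \<and>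
      (G has_derivative (\<lambda>(s, w). w + s *\<^sub>R v)) (at (0, q)) \<and> (\<forall>(t, x)\<in>U. R x (G (t, x)))"
  shows "q \<in> interior {p. R q p}"
proof -
  obtain B where B: "B \<subseteq> V" "independent B" "V \<subseteq> span B"
    using maximal_independent_subset by blast
  then have spB: "span B = UNIV" and finB: "finite B"
    using span span_mono[OF B(3)] independent_imp_finite[OF B(2)] by (auto simp: span_span)
  \<comment> \<open>The coordinates of \<open>w\<close> in the basis \<open>B\<close> will be the
    times for which the successive motions are run.\<close>
  define c where "c b w = representation B w b" for b w
  have c: "bounded_linear (c b)" for b
    using linear_representation[OF B(2) spB, of b] unfolding c_def
    by (intro linear_conv_bounded_linear[THEN iffD1])
       (simp add: linear_def real_scaleR_def[abs_def] scaleR_conv_of_real)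
  \<comment> \<open>Induction over subsets \<open>A\<close> of the basis: \<open>F w\<close> starts
    at \<open>q\<close> and runs the motion belonging to each \<open>b\<close> in \<open>A\<close>
    for the time \<open>c b w\<close>. Its derivative at \<open>0\<close> is the part of
    \<open>w\<close> along \<open>A\<close>.\<close>
  have "\<exists>S F. open S \<and> 0 \<in> S \<and> continuous_on S F \<and> F 0 = q \<and>
      (F has_derivative (\<lambda>w. \<Sum>b\<in>A. c b w *\<^sub>R b)) (at 0) \<and> (\<forall>w\<in>S. R q (F w))"
    if "finite A" "A \<subseteq> V" for A
    using that
  proof (induction A rule: finite_induct)
    case empty
    show ?case
      by (intro exI[of _ UNIV] exI[of _ "\<lambda>_. q"]) (use refl in auto)
  next
    case (insert b A)
    obtain S F where F: "open S" "0 \<in> S" "continuous_on S F" "F 0 = q"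
      "(F has_derivative (\<lambda>w. \<Sum>b\<in>A. c b w *\<^sub>R b)) (at 0)" "\<And>w. w \<in> S \<Longrightarrow> R q (F w)"
      using insert by blast
    obtain U G where G: "open U" "(0, q) \<in> U" "continuous_on U G" "G (0, q) = q"
      "(G has_derivative (\<lambda>(s, w). w + s *\<^sub>R b)) (at (0, q))" "\<And>t x. (t, x) \<in> U \<Longrightarrow> R x (G (t, x))"
      using flow[of b] insert.prems by fast
    define P where "P w = (c b w, F w)" for w
    have c0: "c b 0 = 0" by (simp add: linear_0 bounded_linear.linear c)
    have contP: "continuous_on S P"
      unfolding P_def by (intro continuous_on_Pair F(3) bounded_linear.continuous_on[OF c] continuous_on_id)
    \<comment> \<open>The next motion is available only while its time and its starting point lie in
      \<open>U\<close>, hence the smaller domain.\<close>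
    have "open (S \<inter> P -` U)"
      using continuous_open_preimage[OF contP F(1) G(1)] .
    moreover have "0 \<in> S \<inter> P -` U" using F G c0 by (simp add: P_def)
    moreover have "continuous_on (S \<inter> P -` U) (\<lambda>w. G (P w))"
      by (rule continuous_on_compose2[OF G(3)]) (auto intro: continuous_on_subset[OF contP])
    moreover have "G (P 0) = q" using F G c0 by (simp add: P_def)
    moreover have "((\<lambda>w. G (P w)) has_derivative (\<lambda>w. \<Sum>b\<in>insert b A. c b w *\<^sub>R b)) (at 0)"
    proof -
      have P: "(P has_derivative (\<lambda>w. (c b w, \<Sum>b\<in>A. c b w *\<^sub>R b))) (at 0)"
        unfolding P_def by (intro has_derivative_Pair F(5) bounded_linear_imp_has_derivative c)
      have "(G has_derivative (\<lambda>(s, w). w + s *\<^sub>R b)) (at (P 0))"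
        using G(5) F(4) c0 by (simp add: P_def)
      from has_derivative_compose[OF P this] show ?thesis
        using insert.hyps by (simp add: add.commute)
    qed
    moreover have "R q (G (P w))" if "w \<in> S \<inter> P -` U" for w
      using that F(6) G(6) trans unfolding P_def by blast
    ultimately show ?case by blast
  qed
  from this[OF finB B(1)] obtain S F where F: "open S" "0 \<in> S" "continuous_on S F" "F 0 = q"
    "(F has_derivative (\<lambda>w. \<Sum>b\<in>B. c b w *\<^sub>R b)) (at 0)" "\<And>w. w \<in> S \<Longrightarrow> R q (F w)"
    by blast
  \<comment> \<open>With the whole basis the derivative rebuilds \<open>w\<close> from its
    coordinates. Being the identity, it is surjective, and the open mapping theorem applies.\<close>
  have "(\<lambda>w. \<Sum>b\<in>B. c b w *\<^sub>R b) = id"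
    using sum_representation_eq[OF B(2) _ finB order_refl] spB by (auto simp: c_def)
  then have "F 0 \<in> interior (F ` S)"
    using F by (intro sussmann_open_mapping[OF F(1,3,2,5), of id S]) (auto simp: interior_open)
  moreover have "F ` S \<subseteq> {p. R q p}" using F(6) by auto
  ultimately show ?thesis
    using F(4) interior_mono by blast
qed

section \<open>The flow of the cubic field\<close>

text \<open>In the coordinate \<open>1 / y\<^sup>2\<close> the flow of \<open>x\<^sup>3 \<partial>\<^sub>x\<close> is a translation, and \<open>cubic_flow c\<close>
  subtracts \<open>c\<close>, so \<open>c\<close> is twice the time. It is meaningful only for \<open>c * y\<^sup>2 < 1\<close>.\<close>

definition cubic_flow :: "real \<Rightarrow> real \<Rightarrow> real" where
  "cubic_flow c y = y / sqrt (1 - c * y^2)"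

lemma cubic_flow_power2:
  assumes "c * y^2 < 1"
  shows "(cubic_flow c y)^2 = y^2 / (1 - c * y^2)"
  using assms by (simp add: cubic_flow_def power_divide)

text \<open>By the identity \<open>1 + c * z^2 = 1 / (1 - c * y^2)\<close> for
  \<open>z = cubic_flow c y\<close>, the flow can be run back from wherever it arrives.\<close>

lemma cubic_flow_domain:
  assumes "c * y^2 < 1"
  shows "- c * (cubic_flow c y)^2 < 1"
  using assms by (simp add: cubic_flow_power2 field_simps)

lemma cubic_flow_inverse:
  assumes "c * y^2 < 1"
  shows "cubic_flow (- c) (cubic_flow c y) = y"
proof -
  have "1 - - c * (cubic_flow c y)^2 = 1 / (1 - c * y^2)"
    using assms by (simp add: cubic_flow_power2 field_simps)
  then show ?thesis
    using assms by (simp add: cubic_flow_def[of "- c"] real_sqrt_divide)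
       (simp add: cubic_flow_def)
qed

lemma cubic_flow_inj:
  assumes "c * x^2 < 1" "c * y^2 < 1" "cubic_flow c x = cubic_flow c y"
  shows "x = y"
  using assms cubic_flow_inverse by metis

lemma has_real_derivative_cubic_flow_point:
  assumes "c * y^2 < 1"
  shows "(cubic_flow c has_real_derivative 1 / sqrt (1 - c * y^2) ^ 3) (at y)"
proof -
  define r where "r = sqrt (1 - c * y^2)"
  have r: "r > 0" "r^2 = 1 - c * y^2" using assms by (auto simp: r_def)
  have "(cubic_flow c has_real_derivative
      (1 * r - y * ((0 - c * (2 * y)) * (inverse r / 2))) / (r * r)) (at y)"
    unfolding cubic_flow_def[abs_def] r_def using assms
    by (auto intro!: derivative_eq_intros)
  \<comment> \<open>The numerator on the right is \<open>1\<close>, as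
    \<open>r^2 = 1 - c * y^2\<close>.\<close>
  also have "(1 * r - y * ((0 - c * (2 * y)) * (inverse r / 2))) / (r * r) = (r^2 + c * y^2) / r^3"
    using r(1) by (simp add: field_simps power2_eq_square power3_eq_cube)
  finally show ?thesis using r(2) by (simp add: r_def)
qed

text \<open>This is the flow equation of \<open>x^3\<close>; the factor 1/2 appears because
  \<open>c\<close> is twice the time.\<close>

lemma has_real_derivative_cubic_flow_time:
  assumes "c * y^2 < 1"
  shows "((\<lambda>c. cubic_flow c y) has_real_derivative (cubic_flow c y)^3 / 2) (at c)"
proof -
  define r where "r = sqrt (1 - c * y^2)"
  have r: "r > 0" using assms by (auto simp: r_def)
  have "((\<lambda>c. cubic_flow c y) has_real_derivative
      (0 * r - y * ((0 - y^2) * (inverse r / 2))) / (r * r)) (at c)"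
    unfolding cubic_flow_def[abs_def] r_def using assms
    by (auto intro!: derivative_eq_intros)
  also have "(0 * r - y * ((0 - y^2) * (inverse r / 2))) / (r * r) = (y / r)^3 / 2"
    using r by (simp add: field_simps power2_eq_square power3_eq_cube)
  finally show ?thesis by (simp add: r_def cubic_flow_def)
qed

section \<open>Controlled motions of landmarks\<close>

lemma has_derivative_vecI:
  fixes f :: "'a::real_normed_vector \<Rightarrow> real ^ 'n"
  assumes "\<And>i. ((\<lambda>x. f x $ i) has_derivative (\<lambda>h. f' h $ i)) (at a within S)"
  shows "(f has_derivative f') (at a within S)"
  using assms by (subst has_derivative_componentwise_within) (auto simp: Basis_vec_def inner_axis)

lemma has_vector_derivative_vecI:
  fixes f :: "real \<Rightarrow> real ^ 'n"
  assumes "\<And>i. ((\<lambda>x. f x $ i) has_real_derivative f' $ i) (at a within S)"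
  shows "(f has_vector_derivative f') (at a within S)"
  using assms unfolding has_vector_derivative_def has_field_derivative_def
  by (intro has_derivative_vecI) (simp add: mult_commute_abs)

definition cubic_distribution :: "((real ^ 'n::finite) \<times> (real ^ 'n)) set" where
  "cubic_distribution = span_distribution landmark_manifold {lift_vf (\<lambda>x. 1), lift_vf (\<lambda>x. x ^ 3)}"

lemma mem_cubic_distribution:
  assumes "x \<in> landmark_manifold"
  shows "(x, \<chi> i. a + b * (x $ i) ^ 3) \<in> cubic_distribution"
proof -
  let ?S = "{Z x | Z. Z \<in> {lift_vf (\<lambda>x. 1), lift_vf (\<lambda>x. x ^ 3)}}"
  have "lift_vf (\<lambda>x. 1) x \<in> span ?S" "lift_vf (\<lambda>x. x ^ 3) x \<in> span ?S"
    by (intro span_base; blast)+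
  then have "a *\<^sub>R lift_vf (\<lambda>x. 1) x + b *\<^sub>R lift_vf (\<lambda>x. x ^ 3) x \<in> span ?S"
    by (intro span_add span_scale)
  moreover have "a *\<^sub>R lift_vf (\<lambda>x. 1) x + b *\<^sub>R lift_vf (\<lambda>x. x ^ 3) x = (\<chi> i. a + b * (x $ i) ^ 3)"
    by (simp add: lift_vf_def vec_eq_iff)
  ultimately show ?thesis
    using assms by (simp add: cubic_distribution_def span_distribution_def)
qed

lemma translation_landmark_manifold:
  fixes x :: "real ^ 'n::finite"
  shows "x \<in> landmark_manifold \<Longrightarrow> (\<chi> i. x $ i + s) \<in> landmark_manifold"
  by (simp add: landmark_manifold_def)

text \<open>The flow is injective on its domain, so distinct landmarks stay distinct.\<close>

lemma cubic_flow_landmark_manifold: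
  "x \<in> landmark_manifold \<Longrightarrow> (\<And>i. c * (x $ i)^2 < 1) \<Longrightarrow> (\<chi> i. cubic_flow c (x $ i)) \<in> landmark_manifold"
  using cubic_flow_inj by (fastforce simp: landmark_manifold_def)

lemma reachable_translation:
  fixes x :: "real ^ 'n::finite"
  assumes "x \<in> landmark_manifold"
  shows "reachable landmark_manifold cubic_distribution x (\<chi> i. x $ i + s)"
proof -
  let ?\<gamma> = "\<lambda>t. \<chi> i. x $ i + t * s"
  have "reachable landmark_manifold cubic_distribution (?\<gamma> 0) (?\<gamma> 1)"
  proof (rule reachable_C1[where \<gamma>' = "\<lambda>t. \<chi> i. s"])
    show "?\<gamma> t \<in> landmark_manifold" for t
      using assms by (rule translation_landmark_manifold)
    then show "(?\<gamma> t, \<chi> i. s) \<in> cubic_distribution" for t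
      using mem_cubic_distribution[of "?\<gamma> t" s 0] by simp
    show "(?\<gamma> has_vector_derivative (\<chi> i. s)) (at t)" for t
      by (intro has_vector_derivative_vecI) (auto intro!: derivative_eq_intros)
  qed auto
  then show ?thesis by simp
qed

lemma reachable_cubic_flow:
  fixes x :: "real ^ 'n::finite"
  assumes "x \<in> landmark_manifold" "\<And>i. c * (x $ i)^2 < 1"
  shows "reachable landmark_manifold cubic_distribution x (\<chi> i. cubic_flow c (x $ i))"
proof -
  let ?\<gamma> = "\<lambda>t. \<chi> i. cubic_flow (t * c) (x $ i)"
  let ?\<gamma>' = "\<lambda>t. \<chi> i. c / 2 * (?\<gamma> t $ i) ^ 3"
  \<comment> \<open>The curve stays in the domain of the flow: \<open>t * c * (x $ i)^2\<close> lies
    between \<open>0\<close> and \<open>c * (x $ i)^2\<close>, and both are below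
    \<open>1\<close>.\<close>
  have dom: "(t * c) * (x $ i)^2 < 1" if "t \<in> {0..1}" for t i
  proof (cases "c * (x $ i)^2 \<ge> 0")
    case True
    then have "t * (c * (x $ i)^2) \<le> 1 * (c * (x $ i)^2)"
      using that by (intro mult_right_mono) auto
    then show ?thesis using assms(2)[of i] by (simp add: mult.assoc)
  next
    case False
    then have "t * (c * (x $ i)^2) \<le> 0"
      using that False by (metis atLeastAtMost_iff linear mult_nonneg_nonpos)
    then show ?thesis by (simp add: mult.assoc)
  qed
  have "reachable landmark_manifold cubic_distribution (?\<gamma> 0) (?\<gamma> 1)"
  proof (rule reachable_C1[where \<gamma>' = ?\<gamma>'])
    show M: "?\<gamma> t \<in> landmark_manifold" if "t \<in> {0..1}" for t
      using assms(1) dom[OF that] by (rule cubic_flow_landmark_manifold)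
    show "(?\<gamma> t, ?\<gamma>' t) \<in> cubic_distribution" if "t \<in> {0..1}" for t
      using mem_cubic_distribution[OF M[OF that], of 0 "c / 2"] by simp
    show der: "(?\<gamma> has_vector_derivative ?\<gamma>' t) (at t)" if "t \<in> {0..1}" for t
    proof (rule has_vector_derivative_vecI)
      fix i
      have "((\<lambda>t. t * c) has_real_derivative c) (at t)"
        by (auto intro!: derivative_eq_intros)
      from DERIV_chain2[OF has_real_derivative_cubic_flow_time[OF dom[OF that, of i]] this]
      show "((\<lambda>t. ?\<gamma> t $ i) has_real_derivative ?\<gamma>' t $ i) (at t)" by (simp add: mult.commute)
    qed
    have "continuous_on {0..1} ?\<gamma>"
      using der by (intro continuous_at_imp_continuous_on ballI has_vector_derivative_continuous)
    then have "continuous_on {0..1} (\<lambda>t. ?\<gamma> t $ i)" for i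
      by (rule continuous_on_component)
    then show "continuous_on {0..1} ?\<gamma>'"
      by (intro continuous_on_vec_lambda continuous_on_mult continuous_on_power continuous_on_const)
  qed
  \<comment> \<open>\<open>cubic_flow 0\<close> is the identity, so the curve starts at
    \<open>x\<close>.\<close>
  then show ?thesis by (simp add: cubic_flow_def)
qed

text \<open>A translation by \<open>t\<close>, conjugated by the flow of \<open>(x - a)\<^sup>3 \<partial>\<^sub>x\<close>.\<close>

definition conj_translation :: "real \<Rightarrow> real \<Rightarrow> real \<times> (real ^ 'n::finite) \<Rightarrow> real ^ 'n" where
  "conj_translation c a = (\<lambda>(t, x). \<chi> i. a + cubic_flow c (cubic_flow (- c) (x $ i - a) + t))"

text \<open>For \<open>c > 0\<close> the inner flow is defined on the whole line, as
  \<open>1 + c * y^2 > 0\<close>. Only the way back after the translation can blow up, and the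
  condition excludes this.\<close>

definition conj_translation_domain :: "real \<Rightarrow> real \<Rightarrow> (real \<times> (real ^ 'n::finite)) set" where
  "conj_translation_domain c a =
     {(t, x). x \<in> landmark_manifold \<and> (\<forall>i. c * (cubic_flow (- c) (x $ i - a) + t)^2 < 1)}"

lemma neg_mult_power2_less_1: "c \<ge> 0 \<Longrightarrow> - c * (y::real)^2 < 1"
  by (smt (verit) mult_minus_left zero_le_mult_iff zero_le_power2)

lemma continuous_on_cubic_flow_neg:
  assumes "c \<ge> 0" "continuous_on S f"
  shows "continuous_on S (\<lambda>x. cubic_flow (- c) (f x))"
proof -
  have "sqrt (1 - - c * (f x)^2) \<noteq> 0" for x
    using neg_mult_power2_less_1[OF assms(1), of "f x"] by simp
  then show ?thesis
    unfolding cubic_flow_def by (intro continuous_intros assms(2)) blast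
qed

lemma open_landmark_manifold:
  "open (landmark_manifold :: ('a::euclidean_space ^ 'n::finite) set)"
proof -
  have "landmark_manifold = (\<Inter>i. \<Inter>j\<in>- {i}. {x::'a ^ 'n. x $ i \<noteq> x $ j})"
    by (auto simp: landmark_manifold_def)
  also have "open \<dots>"
    by (intro open_INT ballI open_Collect_neq continuous_intros) auto
  finally show ?thesis .
qed

lemma open_conj_translation_domain:
  assumes "c > 0"
  shows "open (conj_translation_domain c a :: (real \<times> (real ^ 'n::finite)) set)"
proof -
  have "conj_translation_domain c a = (UNIV \<times> landmark_manifold) \<inter>
      (\<Inter>i. {p::real \<times> (real ^ 'n). c * (cubic_flow (- c) (snd p $ i - a) + fst p)^2 < 1})"
    by (auto simp: conj_translation_domain_def)
  also have "open \<dots>"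
    using assms
    by (intro open_Int open_Times open_UNIV open_landmark_manifold open_INT ballI open_Collect_less
        continuous_intros continuous_on_cubic_flow_neg) auto
  finally show ?thesis .
qed

lemma conj_translation_domain_0:
  assumes "c > 0" "x \<in> landmark_manifold"
  shows "(0, x) \<in> conj_translation_domain c a"
  using assms cubic_flow_domain[OF neg_mult_power2_less_1[of c]]
  by (simp add: conj_translation_domain_def)

lemma conj_translation_0:
  assumes "c > 0"
  shows "conj_translation c a (0, x) = x"
  using assms cubic_flow_inverse[OF neg_mult_power2_less_1[of c]]
  by (simp add: conj_translation_def vec_eq_iff)

lemma continuous_on_conj_translation:
  assumes "c > 0"
  shows "continuous_on (conj_translation_domain c a)
    (conj_translation c a :: real \<times> (real ^ 'n::finite) \<Rightarrow> real ^ 'n)"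
proof -
  have "continuous_on (conj_translation_domain c a)
      (\<lambda>p::real \<times> (real ^ 'n). a + cubic_flow c (cubic_flow (- c) (snd p $ i - a) + fst p))" for i
    unfolding cubic_flow_def[of c]
    using assms by (intro continuous_intros continuous_on_cubic_flow_neg)
      (auto simp: conj_translation_domain_def dest: spec[of _ i])
  then show ?thesis
    unfolding conj_translation_def case_prod_unfold by (rule continuous_on_vec_lambda)
qed

text \<open>The motion splits into five legs, each a translation or a flow of \<open>x^3\<close>:
  move \<open>a\<close> to the origin, flow, translate by \<open>t\<close>, flow back, move the
  origin to \<open>a\<close>.\<close>

lemma reachable_conj_translation:
  assumes "c > 0" "(t, x) \<in> conj_translation_domain c a"
  shows "reachable landmark_manifold cubic_distribution x (conj_translation c a (t, x))"
proof -
  let ?R = "reachable landmark_manifold cubic_distribution"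
  have [trans]: "?R u w" if "?R u v" "?R v w" for u v w :: "real ^ 'n"
    using that unfolding cubic_distribution_def by (rule reachable_trans)
  have M: "x \<in> landmark_manifold" and dom: "c * (cubic_flow (- c) (x $ i - a) + t)^2 < 1" for i
    using assms(2) by (auto simp: conj_translation_domain_def)
  define y1 where "y1 = (\<chi> i. x $ i + - a)"
  define y2 where "y2 = (\<chi> i. cubic_flow (- c) (y1 $ i))"
  define y3 where "y3 = (\<chi> i. y2 $ i + t)"
  define y4 where "y4 = (\<chi> i. cubic_flow c (y3 $ i))"
  have neg: "- c * (y1 $ i)^2 < 1" for i
    using assms(1) by (intro neg_mult_power2_less_1) simp
  have dom3: "c * (y3 $ i)^2 < 1" for i
    using dom[of i] by (simp add: y3_def y2_def y1_def)
  have M1: "y1 \<in> landmark_manifold"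
    unfolding y1_def by (rule translation_landmark_manifold[OF M])
  have M2: "y2 \<in> landmark_manifold"
    unfolding y2_def by (rule cubic_flow_landmark_manifold[OF M1 neg])
  have M3: "y3 \<in> landmark_manifold"
    unfolding y3_def by (rule translation_landmark_manifold[OF M2])
  have M4: "y4 \<in> landmark_manifold"
    unfolding y4_def by (rule cubic_flow_landmark_manifold[OF M3 dom3])
  have "?R x y1"
    unfolding y1_def by (rule reachable_translation[OF M])
  also have "?R y1 y2"
    unfolding y2_def by (rule reachable_cubic_flow[OF M1 neg])
  also have "?R y2 y3"
    unfolding y3_def by (rule reachable_translation[OF M2])
  also have "?R y3 y4"
    unfolding y4_def by (rule reachable_cubic_flow[OF M3 dom3])
  also have "?R y4 (\<chi> i. y4 $ i + a)"
    by (rule reachable_translation[OF M4])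
  finally show ?thesis
    by (simp add: conj_translation_def y1_def y2_def y3_def y4_def add.commute)
qed

text \<open>At \<open>t = 0\<close> the outer flow undoes the inner one, so their derivatives are
  reciprocal and the space part is the identity. The time enters between the two flows and is
  stretched by the outer derivative alone.\<close>

lemma has_derivative_conj_translation:
  fixes x :: "real ^ 'n::finite"
  assumes "c > 0"
  shows "(conj_translation c a has_derivative
      (\<lambda>(s, w). w + s *\<^sub>R (\<chi> i. sqrt (1 + c * (x $ i - a)^2) ^ 3))) (at (0, x))"
proof (rule has_derivative_vecI)
  fix i :: 'n
  let ?y = "x $ i - a"
  let ?z = "cubic_flow (- c) ?y"
  let ?m = "sqrt (1 + c * ?y^2) ^ 3"
  have neg: "- c * ?y^2 < 1"
    using assms by (intro neg_mult_power2_less_1) simp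
  then have pos: "1 + c * ?y^2 > 0" by simp
  have dom: "c * ?z^2 < 1"
    using cubic_flow_domain[OF neg] by simp
  have "1 - c * ?z^2 = 1 / (1 + c * ?y^2)"
    using pos by (simp add: cubic_flow_power2[OF neg] field_simps)
  then have "1 / sqrt (1 - c * ?z^2) ^ 3 = ?m"
    by (simp add: real_sqrt_divide power_divide)
  then have outer: "(cubic_flow c has_derivative (*) ?m) (at ?z)"
    using has_real_derivative_cubic_flow_point[OF dom] by (simp add: has_field_derivative_def)
  have inner1: "(cubic_flow (- c) has_derivative (*) (1 / ?m)) (at ?y)"
    using has_real_derivative_cubic_flow_point[OF neg] by (simp add: has_field_derivative_def)
  have "((\<lambda>p. snd p $ i - a) has_derivative (\<lambda>p. snd p $ i)) (at (0::real, x))"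
    by (auto intro!: derivative_eq_intros bounded_linear_imp_has_derivative
        bounded_linear_compose[OF bounded_linear_vec_nth] bounded_linear_snd)
  then have "((\<lambda>p. cubic_flow (- c) (snd p $ i - a)) has_derivative (\<lambda>p. 1 / ?m * (snd p $ i))) (at (0::real, x))"
    by (rule has_derivative_compose[where g = "cubic_flow (- c)" and g' = "(*) (1 / ?m)"])
       (unfold snd_conv, rule inner1)
  then have inner: "((\<lambda>p. cubic_flow (- c) (snd p $ i - a) + fst p) has_derivative
      (\<lambda>p. 1 / ?m * (snd p $ i) + fst p)) (at (0::real, x))"
    by (intro has_derivative_add has_derivative_fst has_derivative_ident)
  have "((\<lambda>p. a + cubic_flow c (cubic_flow (- c) (snd p $ i - a) + fst p)) has_derivative
      (\<lambda>p. 0 + ?m * (1 / ?m * (snd p $ i) + fst p))) (at (0::real, x))"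
    by (intro has_derivative_add has_derivative_const has_derivative_compose[OF inner])
       (use outer in simp)
  moreover have "?m \<noteq> 0" using pos by simp
  ultimately show "((\<lambda>p. conj_translation c a p $ i) has_derivative
      (\<lambda>h. (case h of (s, w) \<Rightarrow> w + s *\<^sub>R (\<chi> i. sqrt (1 + c * (x $ i - a)^2) ^ 3)) $ i)) (at (0, x))"
    by (simp add: conj_translation_def case_prod_unfold distrib_left mult.commute)
qed

section \<open>The directions span\<close>

text \<open>The fourth central difference with step \<open>h\<close> annihilates \<open>\<bar>u\<bar>\<^sup>3\<close> unless its
  window meets the kink at \<open>0\<close>.\<close>

lemma cubed_distances_independent:
  fixes l x :: "real ^ 'n::finite"
  assumes x: "x \<in> landmark_manifold"
    and zero: "\<And>a. (\<Sum>i\<in>UNIV. l $ i * \<bar>x $ i - a\<bar> ^ 3) = 0"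
  shows "l = 0"
proof -
  have "l $ j = 0" for j
  proof -
    obtain d where d: "d > 0" "\<And>y. y \<in> range (($) x) \<Longrightarrow> y \<noteq> x $ j \<Longrightarrow> d \<le> dist (x $ j) y"
      using finite_set_avoid[of "range (($) x)" "x $ j"] by auto
    \<comment> \<open>The difference window centred at \<open>x $ j\<close> has radius
      \<open>2 * h = d\<close>, so its interior contains no other landmark.\<close>
    define h where "h = d / 2"
    have h: "h > 0" using d by (simp add: h_def)
    have far: "2 * h \<le> \<bar>x $ i - x $ j\<bar>" if "i \<noteq> j" for i
      using d(2)[of "x $ i"] x that by (auto simp: landmark_manifold_def dist_real_def h_def abs_minus_commute)
    define D where "D u = \<bar>u - 2 * h\<bar>^3 - 4 * \<bar>u - h\<bar>^3 + 6 * \<bar>u\<bar>^3 - 4 * \<bar>u + h\<bar>^3 + \<bar>u + 2 * h\<bar>^3" for u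
    \<comment> \<open>Here the five arguments have the same weak sign, so \<open>D u\<close> is, up
      to sign, a fourth difference of a cubic polynomial, which vanishes.\<close>
    have D0: "D u = 0" if "2 * h \<le> \<bar>u\<bar>" for u
    proof (cases "u \<ge> 0")
      case True
      then show ?thesis using that h unfolding D_def
        by (simp add: abs_of_nonneg) (simp add: power3_eq_cube algebra_simps)
    next
      case False
      then show ?thesis using that h unfolding D_def
        by (simp add: abs_of_nonpos) (simp add: power3_eq_cube algebra_simps)
    qed
    define \<Sigma> where "\<Sigma> a = (\<Sum>i\<in>UNIV. l $ i * \<bar>x $ i - a\<bar> ^ 3)" for a
    \<comment> \<open>Taking the fourth difference in \<open>a\<close> of the vanishing sum, centred
      at \<open>x $ j\<close>, isolates the coefficient \<open>l $ j\<close>.\<close>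
    have "0 = \<Sigma> (x $ j + 2 * h) - 4 * \<Sigma> (x $ j + h) + 6 * \<Sigma> (x $ j) - 4 * \<Sigma> (x $ j - h) + \<Sigma> (x $ j - 2 * h)"
      unfolding \<Sigma>_def zero by simp
    also have "\<dots> = (\<Sum>i\<in>UNIV. l $ i * D (x $ i - x $ j))"
      unfolding \<Sigma>_def sum_distrib_left sum.distrib[symmetric] sum_subtractf[symmetric]
    proof (rule sum.cong[OF refl])
      fix i
      have "x $ i - (x $ j + 2 * h) = x $ i - x $ j - 2 * h" "x $ i - (x $ j + h) = x $ i - x $ j - h"
        "x $ i - (x $ j - 2 * h) = x $ i - x $ j + 2 * h" "x $ i - (x $ j - h) = x $ i - x $ j + h"
        by simp_all
      then show "l $ i * \<bar>x $ i - (x $ j + 2 * h)\<bar> ^ 3 - 4 * (l $ i * \<bar>x $ i - (x $ j + h)\<bar> ^ 3) +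
          6 * (l $ i * \<bar>x $ i - x $ j\<bar> ^ 3) - 4 * (l $ i * \<bar>x $ i - (x $ j - h)\<bar> ^ 3) +
          l $ i * \<bar>x $ i - (x $ j - 2 * h)\<bar> ^ 3 = l $ i * D (x $ i - x $ j)"
        unfolding D_def
        by (simp only: distrib_left right_diff_distrib mult.left_commute[of "l $ i" 4] mult.left_commute[of "l $ i" 6])
    qed
    also have "\<dots> = (\<Sum>i\<in>UNIV. if i = j then l $ j * D 0 else 0)"
      by (intro sum.cong) (use far D0 in auto)
    \<comment> \<open>At the kink, \<open>D 0 = (8 - 4 - 4 + 8) * h^3\<close>.\<close>
    also have "\<dots> = l $ j * (8 * h ^ 3)"
      using h by (simp add: D_def power_mult_distrib abs_mult)
    finally show ?thesis using h by simp
  qed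
  then show ?thesis by (simp add: vec_eq_iff)
qed

lemma span_conj_translation_directions:
  fixes x :: "real ^ 'n::finite"
  assumes "x \<in> landmark_manifold"
  shows "span {\<chi> i. sqrt (1 + c * (x $ i - a)^2) ^ 3 | c a. c > 0} = UNIV" (is "span ?V = UNIV")
proof (rule ccontr)
  assume "span ?V \<noteq> UNIV"
  then obtain l where l: "l \<noteq> 0" "\<And>v. v \<in> span ?V \<Longrightarrow> l \<bullet> v = 0"
    using span_not_UNIV_orthogonal by blast
  have "(\<Sum>i\<in>UNIV. l $ i * \<bar>x $ i - a\<bar> ^ 3) = 0" for a
  proof -
    \<comment> \<open>Here \<open>e = 1 / c\<close>: scaling the velocities by
      \<open>sqrt e ^ 3\<close> turns the limit of large \<open>c\<close> into the value at
      \<open>e = 0\<close> of a continuous function, where \<open>sqrt\<close> of the square is the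
      absolute value.\<close>
    let ?f = "\<lambda>e. \<Sum>i\<in>UNIV. l $ i * sqrt (e + (x $ i - a)^2) ^ 3"
    have "?f e = 0" if "e > 0" for e
    proof -
      have "sqrt (e + (x $ i - a)^2) = sqrt e * sqrt (1 + 1 / e * (x $ i - a)^2)" for i
        using that by (simp add: real_sqrt_mult[symmetric] field_simps)
      then have "?f e = sqrt e ^ 3 * (l \<bullet> (\<chi> i. sqrt (1 + 1 / e * (x $ i - a)^2) ^ 3))"
        by (simp add: inner_vec_def sum_distrib_left power_mult_distrib mult_ac)
      also have "l \<bullet> (\<chi> i. sqrt (1 + 1 / e * (x $ i - a)^2) ^ 3) = 0"
        using that by (intro l(2) span_base CollectI exI[of _ "1 / e"] exI[of _ a]) auto
      finally show ?thesis by simp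
    qed
    then have "(?f \<longlongrightarrow> 0) (at_right 0)"
      by (intro tendsto_eventually) (auto simp: eventually_at_right_less eventually_at_filter)
    moreover have "(?f \<longlongrightarrow> ?f 0) (at_right 0)"
      by (intro tendsto_intros tendsto_add[of "\<lambda>e. e" 0, simplified])
    ultimately have "?f 0 = 0"
      using tendsto_unique trivial_limit_at_right_real by blast
    then show ?thesis by simp
  qed
  with cubed_distances_independent[OF assms] l(1) show False by blast
qed

section \<open>Controllability\<close>

lemma ordered_landmarks_subset: "ordered_landmarks \<subseteq> landmark_manifold"
  unfolding ordered_landmarks_def landmark_manifold_def by (force simp: neq_iff)

text \<open>The order conditions are linear inequalities, so the set is an intersection of
  half-spaces.\<close>

lemma convex_ordered_landmarks:
  "convex (ordered_landmarks :: (real ^ 'n::{finite,linorder}) set)"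
proof -
  have "ordered_landmarks = (\<Inter>i. \<Inter>j\<in>{i<..}. {x::(real, 'n) vec. (axis i 1 - axis j 1) \<bullet> x < 0})"
    by (auto simp: ordered_landmarks_def inner_diff_left inner_axis')
  also have "convex \<dots>"
    by (intro convex_INT convex_halfspace_lt)
  finally show ?thesis .
qed

text \<open>The argument is topological and works for every \<open>E\<close>: if two landmarks
  changed their order, the intermediate value theorem would give a time at which they collide, and
  the curve would have left the manifold.\<close>

lemma orbit_subset_ordered_landmarks:
  assumes "q \<in> ordered_landmarks"
  shows "orbit landmark_manifold E q \<subseteq> ordered_landmarks"
proof
  fix p assume "p \<in> orbit landmark_manifold E q"
  then obtain \<gamma> where \<gamma>: "\<gamma> ` {0..1} \<subseteq> landmark_manifold" "absolutely_continuous_on 0 1 \<gamma>" "\<gamma> 0 = q" "\<gamma> 1 = p"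
    by (auto simp: orbit_def horizontal_curve_def)
  have "p $ i < p $ j" if "i < j" for i j
  proof (rule ccontr)
    let ?f = "\<lambda>t. \<gamma> t $ j - \<gamma> t $ i"
    assume "\<not> p $ i < p $ j"
    then have "?f 1 \<le> 0" using \<gamma> by simp
    moreover have "?f 0 \<ge> 0" using assms that \<gamma>(3) by (auto simp: ordered_landmarks_def less_imp_le)
    moreover have "continuous_on {0..1} ?f"
      using absolutely_continuous_on_imp_continuous_on[OF \<gamma>(2)] by (intro continuous_intros)
    ultimately obtain t where "t \<in> {0..1}" "?f t = 0"
      using IVT2'[of ?f 1 0 0] by auto
    then have "\<gamma> t \<in> landmark_manifold" "\<gamma> t $ j = \<gamma> t $ i" using \<gamma>(1) by auto
    then show False using that by (auto simp: landmark_manifold_def)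
  qed
  then show "p \<in> ordered_landmarks" by (simp add: ordered_landmarks_def)
qed

theorem theorem3p1:
  fixes X0 X3 :: "real \<Rightarrow> real"
    and M :: "(real ^ 'n::{finite,linorder}) set"
    and E :: "((real, 'n) vec \<times> (real, 'n) vec) set"
  assumes "X0 = (\<lambda>x. 1)"
    and "X3 = (\<lambda>x. x ^ 3)"
    and "M = landmark_manifold"
    and "E = span_distribution M {lift_vf X0, lift_vf X3}"
  shows "completely_controllable_on ordered_landmarks M E"
proof -
  have E: "E = cubic_distribution"
    using assms by (simp add: cubic_distribution_def)
  let ?R = "reachable M E"
  \<comment> \<open>On a connected set, a symmetric and transitive relation in which every point is
    related to a whole neighbourhood of itself relates any two points.\<close>
  have "?R q p" if "q \<in> ordered_landmarks" "p \<in> ordered_landmarks" for q p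
  proof (rule connected_equivalence_relation[OF convex_connected[OF convex_ordered_landmarks] that])
    show "?R y x" if "?R x y" for x y
      using that unfolding assms(4) by (rule reachable_sym)
    show trans: "?R x z" if "?R x y" "?R y z" for x y z
      using that unfolding assms(4) by (rule reachable_trans)
    fix x :: "(real, 'n) vec" assume "x \<in> ordered_landmarks"
    then have x: "x \<in> landmark_manifold" using ordered_landmarks_subset by blast
    \<comment> \<open>Each spanning direction is the initial velocity of the conjugated translation
      with the same \<open>c\<close> and \<open>a\<close>.\<close>
    have "x \<in> interior {p. ?R x p}"
    proof (rule interior_related_points[OF span_conj_translation_directions[OF x] _ trans])
      show "?R x x" unfolding assms(4) using x by (simp add: reachable_refl assms(3))
      fix v assume "v \<in> {\<chi> i. sqrt (1 + c * (x $ i - a)^2) ^ 3 | c a. c > 0}"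
      then obtain c a where "c > 0" and v: "v = (\<chi> i. sqrt (1 + c * (x $ i - a)^2) ^ 3)"
        by blast
      have "\<forall>(t, y)\<in>conj_translation_domain c a. ?R y (conj_translation c a (t, y))"
        using reachable_conj_translation[OF \<open>c > 0\<close>] unfolding E assms(3) by blast
      then show "\<exists>U G. open U \<and> (0::real, x) \<in> U \<and> continuous_on U G \<and> G (0, x) = x \<and>
          (G has_derivative (\<lambda>(s, w). w + s *\<^sub>R v)) (at (0, x)) \<and> (\<forall>(t, y)\<in>U. ?R y (G (t, y)))"
        unfolding v
        by (intro exI[of _ "conj_translation_domain c a"] exI[of _ "conj_translation c a"] conjI
            open_conj_translation_domain conj_translation_domain_0 conj_translation_0 x \<open>c > 0\<close>
            continuous_on_conj_translation has_derivative_conj_translation)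
    qed
    then show "\<exists>T. openin (top_of_set ordered_landmarks) T \<and> x \<in> T \<and> (\<forall>y\<in>T. ?R x y)"
      using \<open>x \<in> ordered_landmarks\<close> interior_subset
      by (intro exI[of _ "ordered_landmarks \<inter> interior {p. ?R x p}"]) auto
  qed
  \<comment> \<open>One inclusion is the reachability just shown, the other that no horizontal curve
    leaves \<open>ordered_landmarks\<close>.\<close>
  then have "orbit M E q = ordered_landmarks" if "q \<in> ordered_landmarks" for q
    using that reachable_imp_orbit orbit_subset_ordered_landmarks[OF that, of E] assms(3) by blast
  then show ?thesis by (simp add: completely_controllable_on_def)
qed

end
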